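(* Let $1\le p_i\le+\infty$ and $\omega_i>0$ for $i=1,\dots,m$, and let $x_s\in P_s$, $x_t\in P_t$ with $s\neq t$. The shortest path problem (SPP) defining $D(x_s,x_t)$ is equivalent to the following mixed-integer problem (SPP-F2): $$\min \sum_{i\in V}\omega_i d_i$$ subject to 1. $\sum_{(s,j)\in A} z_{sj}-\sum_{(h,s)\in A} z_{hs}=1$; 2. $\sum_{(i,j)\in A} z_{ij}-\sum_{(h,i)\in A} z_{hi}=0$ for all $i\in V\setminus\{s,t\}$; 3. $\sum_{(t,j)\in A} z_{tj}-\sum_{(h,t)\in A} z_{ht}=-1$; 4. $\sum_{(h,i)\in A} z_{hi}\le 1$ for all $i\in V$; 5. $\sum_{(i,j)\in A} z_{ij}\le 1$ for all $i\in V$; 6. $d_s\ge \sum_{(s,j)\in A}\big\|\sum_{e\in \mathrm{Ext}(F_{sj})}\lambda_{sje}e-x_s z_{sj}\big\|_{p_s}$; 7. $d_i\ge \sum_{(h,i)\in A}\sum_{(i,j)\in A}\big\|\sum_{e\in \mathrm{Ext}(F_{ij})}\Psi_{hije}e-\sum_{e\in \mathrm{Ext}(F_{hi})}\Phi_{hije}e\big\|_{p_i}$ for all $i\in V\setminus\{s,t\}$; 8. $d_t\ge \sum_{(h,t)\in A}\big\|x_t z_{ht}-\sum_{e\in \mathrm{Ext}(F_{ht})}\lambda_{hte}e\big\|_{p_t}$; 9. $\sum_{e\in \mathrm{Ext}(F_{ij})}\lambda_{ije}=z_{ij}$ for all $(i,j)\in A$; 10. $\sum_{(i,j)\in A}\rho_{hij}=z_{hi}$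 for all $i\in V\setminus\{s,t\}$, $(h,i)\in A$; 11. $\sum_{(h,i)\in A}\rho_{hij}=z_{ij}$ for all $i\in V\setminus\{s,t\}$, $(i,j)\in A$; 12. $\sum_{e\in \mathrm{Ext}(F_{hi})}\Phi_{hije}=\rho_{hij}$ for all $i\in V\setminus\{s,t\}$, $(h,i),(i,j)\in A$; 13. $\sum_{(i,j)\in A}\Phi_{hije}=\lambda_{hie}$ for all $i\in V\setminus\{s,t\}$, $(h,i)\in A$, $e\in \mathrm{Ext}(F_{hi})$; 14. $\sum_{e\in \mathrm{Ext}(F_{ij})}\Psi_{hije}=\rho_{hij}$ for all $i\in V\setminus\{s,t\}$, $(h,i),(i,j)\in A$; 15. $\sum_{(h,i)\in A}\Psi_{hije}=\lambda_{ije}$ for all $i\in V\setminus\{s,t\}$, $(i,j)\in A$, $e\in \mathrm{Ext}(F_{ij})$; 16. $d_i\ge0$ for all $i\in V$; $z_{ij}\in\{0,1\}$ for all $(i,j)\in A$; $\lambda_{ije}\ge0$ for all $(i,j)\in A$, $e\in \mathrm{Ext}(F_{ij})$; and, for all $i\in V\setminus\{s,t\}$ and $(h,i),(i,j)\in A$: $\rho_{hij}\ge0$, $\Phi_{hije}\ge0$ for $e\in \mathrm{Ext}(F_{hi})$, $\Psi_{hije}\ge0$ for $e\in \mathrm{Ext}(F_{ij})$. Here "equivalent" means: the optimal value of (SPP-F2) equals $D(x_s,x_t)$; every optimal solution of (SPP), i.e. a simple path $\gamma\in\Gamma$ with gate points, gives an optimal solution of (SPP-F2) by setting $z_{ij}=1$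 exactly on the arcs traversed by $\gamma$ and letting $(\lambda_{ije})_e$ be convex-combination coefficients of the gate point in $F_{ij}$ on those arcs (and $0$ elsewhere), with suitable values of the remaining variables; and conversely, for every optimal solution of (SPP-F2) the arcs with $z_{ij}=1$ contain a simple path from $s$ to $t$ which, together with the gate points $\sum_{e\in \mathrm{Ext}(F_{ij})}\lambda_{ije}e$ on its arcs, is optimal for (SPP).
   Context: Setting. $P_1,\dots,P_m\subseteq\mathbb{R}^d$ are the cells of a polyhedral subdivision, with $\mathrm{int}(P_i)\cap\mathrm{int}(P_j)=\emptyset$ for $i\ne j$; the cells are assumed to be polytopes (bounded polyhedra). Cell $P_i$ is endowed with the $\ell_{p_i}$-norm $\|\cdot\|_{p_i}$ and a weight $\omega_i>0$. The undirected graph $G=(V,E)$ has $V=\{1,\dots,m\}$ and $\{i,j\}\in E$ ($i\ne j$) iff $P_i$ and $P_j$ have a common (nonempty) face; for $\{i,j\}\in E$, $F_{ij}=F_{ji}=P_i\cap P_j$ denotes the maximal common face of $P_i$ and $P_j$ (a polytope). $\mathrm{Ext}(\cdot)$ denotes the set of extreme points of a polytope; $\mathrm{Ext}(F_{ij})=\mathrm{Ext}(P_i)\cap \mathrm{Ext}(P_j)$. $A=\{(i,j),(j,i):\{i,j\}\in E\}$ is the set of arcs of the directed version of $G$. In sums such as $\sum_{(i,j)\in A}$ or $\sum_{(h,i)\in A}$ with $i$ fixed, the sum runs over all $j$ (resp. $h$) for which the pair is an arc. A point lying in several cells is assigned to exactly one of them in advance; $s,t$ are the indices of the cells assigned to $x_s,x_t$.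 $\Gamma$ is the set of simple paths $(s,i_1,\dots,i_k,t)$ from $s$ to $t$ in $G$ (all vertices distinct; $k\ge0$). Problem (SPP), for $s\ne t$: with $i_0=s$, $i_{k+1}=t$, $$D(x_s,x_t)=\inf\ \ \omega_s\|y_{s i_1}-x_s\|_{p_s}+\sum_{r=1}^{k}\omega_{i_r}\|y_{i_r i_{r+1}}-y_{i_{r-1}i_r}\|_{p_{i_r}}+\omega_t\|x_t-y_{i_k t}\|_{p_t},$$ the infimum being over all $(s,i_1,\dots,i_k,t)\in\Gamma$ and all gate points $y_{i_r i_{r+1}}\in F_{i_r i_{r+1}}$, $r=0,\dots,k$ (value $+\infty$ if there is no feasible choice, and likewise for infeasible minimization problems). *)

theory Defs
  imports "HOL-Analysis.Analysis"
begin

definition lp_norm :: "ereal \<Rightarrow> real ^ 'n \<Rightarrow> real" where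
  "lp_norm p x =
     (if p = \<infinity> then infnorm x
      else (\<Sum>k\<in>UNIV. \<bar>x $ k\<bar> powr real_of_ereal p) powr (1 / real_of_ereal p))"

(* Face-to-face: the intersection of two cells is a (possibly empty) face of both.
   As in the library's cell complexes, cells are not required to be full-dimensional. *)
definition polyhedral_subdivision :: "nat \<Rightarrow> (nat \<Rightarrow> (real ^ 'n) set) \<Rightarrow> bool" where
  "polyhedral_subdivision m P \<longleftrightarrow>
     (\<forall>i\<in>{1..m}. polytope (P i)) \<and>
     (\<forall>i\<in>{1..m}. \<forall>j\<in>{1..m}. P i \<inter> P j face_of P i \<and> P i \<inter> P j face_of P j) \<and>
     (\<forall>i\<in>{1..m}. \<forall>j\<in>{1..m}. i \<noteq> j \<longrightarrow> interior (P i) \<inter> interior (P j) = {})"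

definition edges :: "nat \<Rightarrow> (nat \<Rightarrow> (real ^ 'n) set) \<Rightarrow> nat set set" where
  "edges m P = {{i, j} | i j. i \<in> {1..m} \<and> j \<in> {1..m} \<and> i \<noteq> j \<and>
                  (\<exists>F. F \<noteq> {} \<and> F face_of P i \<and> F face_of P j)}"

definition arcs :: "nat \<Rightarrow> (nat \<Rightarrow> (real ^ 'n) set) \<Rightarrow> (nat \<times> nat) set" where
  "arcs m P = {(i, j). {i, j} \<in> edges m P}"

definition common_face :: "(nat \<Rightarrow> (real ^ 'n) set) \<Rightarrow> nat \<Rightarrow> nat \<Rightarrow> (real ^ 'n) set" where
  "common_face P i j = P i \<inter> P j"

definition Ext :: "(real ^ 'n) set \<Rightarrow> (real ^ 'n) set" where
  "Ext S = {x. x extreme_point_of S}"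

definition simple_paths :: "nat \<Rightarrow> (nat \<Rightarrow> (real ^ 'n) set) \<Rightarrow> nat \<Rightarrow> nat \<Rightarrow> nat list set" where
  "simple_paths m P s t =
     {\<gamma>. \<gamma> \<noteq> [] \<and> hd \<gamma> = s \<and> last \<gamma> = t \<and> set \<gamma> \<subseteq> {1..m} \<and> distinct \<gamma> \<and>
          successively (\<lambda>i j. {i, j} \<in> edges m P) \<gamma>}"

definition path_arcs :: "nat list \<Rightarrow> (nat \<times> nat) set" where
  "path_arcs \<gamma> = set (zip \<gamma> (tl \<gamma>))"

(* Gate points are indexed by pairs of cells; only the values y i j on arcs of the path matter. *)
definition spp_feasible ::
  "nat \<Rightarrow> (nat \<Rightarrow> (real ^ 'n) set) \<Rightarrow> nat \<Rightarrow> nat \<Rightarrow> nat list \<Rightarrow> (nat \<Rightarrow> nat \<Rightarrow> real ^ 'n) \<Rightarrow> bool" where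
  "spp_feasible m P s t \<gamma> y \<longleftrightarrow>
     \<gamma> \<in> simple_paths m P s t \<and> (\<forall>(i, j)\<in>path_arcs \<gamma>. y i j \<in> common_face P i j)"

(* The path is (\<gamma> ! 0, ..., \<gamma> ! Suc k), with k = length \<gamma> - 2 intermediate cells;
   meaningful for length \<gamma> at least 2, which holds for simple paths with s \<noteq> t. *)
definition spp_cost ::
  "(nat \<Rightarrow> ereal) \<Rightarrow> (nat \<Rightarrow> real) \<Rightarrow> nat \<Rightarrow> nat \<Rightarrow> real ^ 'n \<Rightarrow> real ^ 'n \<Rightarrow>
   nat list \<Rightarrow> (nat \<Rightarrow> nat \<Rightarrow> real ^ 'n) \<Rightarrow> real" where
  "spp_cost p w s t xs xt \<gamma> y =
     (let k = length \<gamma> - 2 in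
        w s * lp_norm (p s) (y s (\<gamma> ! 1) - xs)
      + (\<Sum>r = 1..k. w (\<gamma> ! r) *
           lp_norm (p (\<gamma> ! r)) (y (\<gamma> ! r) (\<gamma> ! (r + 1)) - y (\<gamma> ! (r - 1)) (\<gamma> ! r)))
      + w t * lp_norm (p t) (xt - y (\<gamma> ! k) t))"

definition spp_value ::
  "nat \<Rightarrow> (nat \<Rightarrow> (real ^ 'n) set) \<Rightarrow> (nat \<Rightarrow> ereal) \<Rightarrow> (nat \<Rightarrow> real) \<Rightarrow>
   nat \<Rightarrow> nat \<Rightarrow> real ^ 'n \<Rightarrow> real ^ 'n \<Rightarrow> ereal" where
  "spp_value m P p w s t xs xt =
     (INF (\<gamma>, y) \<in> {(\<gamma>, y). spp_feasible m P s t \<gamma> y}. ereal (spp_cost p w s t xs xt \<gamma> y))"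

definition spp_optimal ::
  "nat \<Rightarrow> (nat \<Rightarrow> (real ^ 'n) set) \<Rightarrow> (nat \<Rightarrow> ereal) \<Rightarrow> (nat \<Rightarrow> real) \<Rightarrow>
   nat \<Rightarrow> nat \<Rightarrow> real ^ 'n \<Rightarrow> real ^ 'n \<Rightarrow> nat list \<Rightarrow> (nat \<Rightarrow> nat \<Rightarrow> real ^ 'n) \<Rightarrow> bool" where
  "spp_optimal m P p w s t xs xt \<gamma> y \<longleftrightarrow>
     spp_feasible m P s t \<gamma> y \<and>
     (\<forall>\<gamma>' y'. spp_feasible m P s t \<gamma>' y' \<longrightarrow>
        spp_cost p w s t xs xt \<gamma> y \<le> spp_cost p w s t xs xt \<gamma>' y')"

(* Variables are total functions; values outside the index ranges of the model are irrelevant. *)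
record 'n f2_sol =
  dv :: "nat \<Rightarrow> real"
  zv :: "nat \<Rightarrow> nat \<Rightarrow> real"
  lamv :: "nat \<Rightarrow> nat \<Rightarrow> real ^ 'n \<Rightarrow> real"
  rhov :: "nat \<Rightarrow> nat \<Rightarrow> nat \<Rightarrow> real"
  Phiv :: "nat \<Rightarrow> nat \<Rightarrow> nat \<Rightarrow> real ^ 'n \<Rightarrow> real"
  Psiv :: "nat \<Rightarrow> nat \<Rightarrow> nat \<Rightarrow> real ^ 'n \<Rightarrow> real"

definition f2_feasible ::
  "nat \<Rightarrow> (nat \<Rightarrow> (real ^ 'n) set) \<Rightarrow> (nat \<Rightarrow> ereal) \<Rightarrow>
   nat \<Rightarrow> nat \<Rightarrow> real ^ 'n \<Rightarrow> real ^ 'n \<Rightarrow> 'n f2_sol \<Rightarrow> bool" where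
  "f2_feasible m P p s t xs xt S \<longleftrightarrow>
    (let V = {1..m}; A = arcs m P; X = (\<lambda>i j. Ext (common_face P i j));
         d = dv S; z = zv S; lam = lamv S; rho = rhov S; Phi = Phiv S; Psi = Psiv S
     in
      (\<Sum>j | (s, j) \<in> A. z s j) - (\<Sum>h | (h, s) \<in> A. z h s) = 1 \<and>
      (\<forall>i \<in> V - {s, t}. (\<Sum>j | (i, j) \<in> A. z i j) - (\<Sum>h | (h, i) \<in> A. z h i) = 0) \<and>
      (\<Sum>j | (t, j) \<in> A. z t j) - (\<Sum>h | (h, t) \<in> A. z h t) = - 1 \<and>
      (\<forall>i \<in> V. (\<Sum>h | (h, i) \<in> A. z h i) \<le> 1) \<and>
      (\<forall>i \<in> V. (\<Sum>j | (i, j) \<in> A. z i j) \<le> 1) \<and>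
      d s \<ge> (\<Sum>j | (s, j) \<in> A.
               lp_norm (p s) ((\<Sum>e \<in> X s j. lam s j e *\<^sub>R e) - z s j *\<^sub>R xs)) \<and>
      (\<forall>i \<in> V - {s, t}.
        d i \<ge> (\<Sum>h | (h, i) \<in> A. \<Sum>j | (i, j) \<in> A.
                 lp_norm (p i) ((\<Sum>e \<in> X i j. Psi h i j e *\<^sub>R e)
                                - (\<Sum>e \<in> X h i. Phi h i j e *\<^sub>R e)))) \<and>
      d t \<ge> (\<Sum>h | (h, t) \<in> A.
               lp_norm (p t) (z h t *\<^sub>R xt - (\<Sum>e \<in> X h t. lam h t e *\<^sub>R e))) \<and>
      (\<forall>(i, j) \<in> A. (\<Sum>e \<in> X i j. lam i j e) = z i j) \<and>
      (\<forall>i \<in> V - {s, t}. \<forall>h. (h, i) \<in> A \<longrightarrow> (\<Sum>j | (i, j) \<in> A. rho h i j) = z h i) \<and>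
      (\<forall>i \<in> V - {s, t}. \<forall>j. (i, j) \<in> A \<longrightarrow> (\<Sum>h | (h, i) \<in> A. rho h i j) = z i j) \<and>
      (\<forall>i \<in> V - {s, t}. \<forall>h j. (h, i) \<in> A \<and> (i, j) \<in> A \<longrightarrow>
        (\<Sum>e \<in> X h i. Phi h i j e) = rho h i j) \<and>
      (\<forall>i \<in> V - {s, t}. \<forall>h. (h, i) \<in> A \<longrightarrow>
        (\<forall>e \<in> X h i. (\<Sum>j | (i, j) \<in> A. Phi h i j e) = lam h i e)) \<and>
      (\<forall>i \<in> V - {s, t}. \<forall>h j. (h, i) \<in> A \<and> (i, j) \<in> A \<longrightarrow>
        (\<Sum>e \<in> X i j. Psi h i j e) = rho h i j) \<and>
      (\<forall>i \<in> V - {s, t}. \<forall>j. (i, j) \<in> A \<longrightarrow>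
        (\<forall>e \<in> X i j. (\<Sum>h | (h, i) \<in> A. Psi h i j e) = lam i j e)) \<and>
      (\<forall>i \<in> V. d i \<ge> 0) \<and>
      (\<forall>(i, j) \<in> A. z i j \<in> {0, 1}) \<and>
      (\<forall>(i, j) \<in> A. \<forall>e \<in> X i j. lam i j e \<ge> 0) \<and>
      (\<forall>i \<in> V - {s, t}. \<forall>h j. (h, i) \<in> A \<and> (i, j) \<in> A \<longrightarrow>
        rho h i j \<ge> 0 \<and>
        (\<forall>e \<in> X h i. Phi h i j e \<ge> 0) \<and>
        (\<forall>e \<in> X i j. Psi h i j e \<ge> 0)))"

definition f2_cost :: "nat \<Rightarrow> (nat \<Rightarrow> real) \<Rightarrow> 'n::finite f2_sol \<Rightarrow> real" where
  "f2_cost m w S = (\<Sum>i \<in> {1..m}. w i * dv S i)"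

definition f2_value ::
  "nat \<Rightarrow> (nat \<Rightarrow> (real ^ 'n) set) \<Rightarrow> (nat \<Rightarrow> ereal) \<Rightarrow> (nat \<Rightarrow> real) \<Rightarrow>
   nat \<Rightarrow> nat \<Rightarrow> real ^ 'n \<Rightarrow> real ^ 'n \<Rightarrow> ereal" where
  "f2_value m P p w s t xs xt =
     (INF S \<in> {S. f2_feasible m P p s t xs xt S}. ereal (f2_cost m w S))"

definition f2_optimal ::
  "nat \<Rightarrow> (nat \<Rightarrow> (real ^ 'n) set) \<Rightarrow> (nat \<Rightarrow> ereal) \<Rightarrow> (nat \<Rightarrow> real) \<Rightarrow>
   nat \<Rightarrow> nat \<Rightarrow> real ^ 'n \<Rightarrow> real ^ 'n \<Rightarrow> 'n f2_sol \<Rightarrow> bool" where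
  "f2_optimal m P p w s t xs xt S \<longleftrightarrow>
     f2_feasible m P p s t xs xt S \<and>
     (\<forall>S'. f2_feasible m P p s t xs xt S' \<longrightarrow> f2_cost m w S \<le> f2_cost m w S')"

definition path_coefficients ::
  "nat \<Rightarrow> (nat \<Rightarrow> (real ^ 'n) set) \<Rightarrow> nat list \<Rightarrow> (nat \<Rightarrow> nat \<Rightarrow> real ^ 'n) \<Rightarrow>
   (nat \<Rightarrow> nat \<Rightarrow> real ^ 'n \<Rightarrow> real) \<Rightarrow> bool" where
  "path_coefficients m P \<gamma> y lam \<longleftrightarrow>
     (\<forall>(i, j) \<in> path_arcs \<gamma>.
        (\<forall>e \<in> Ext (common_face P i j). lam i j e \<ge> 0) \<and>
        (\<Sum>e \<in> Ext (common_face P i j). lam i j e) = 1 \<and>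
        (\<Sum>e \<in> Ext (common_face P i j). lam i j e *\<^sub>R e) = y i j) \<and>
     (\<forall>(i, j) \<in> arcs m P - path_arcs \<gamma>. \<forall>e \<in> Ext (common_face P i j). lam i j e = 0)"

definition gate_points ::
  "(nat \<Rightarrow> (real ^ 'n) set) \<Rightarrow> 'n f2_sol \<Rightarrow> nat \<Rightarrow> nat \<Rightarrow> real ^ 'n" where
  "gate_points P S i j = (\<Sum>e \<in> Ext (common_face P i j). lamv S i j e *\<^sub>R e)"

end

(* For binary z, the degree and balance constraints say that the arcs with z = 1 form a simple path
   from s to t together with disjoint cycles.  On a path cell, rho is forced to be the indicator of
   the pair (entering arc, leaving arc), so Phi and Psi restrict to lambda there and each d_i
   dominates one term of the SPP cost; cycles only add nonnegative cost.  Conversely, a path with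
   gate points gives a solution of the same cost by taking products: rho = z z, Phi = lambda z,
   Psi = z lambda.  Minimizers exist because there are finitely many simple paths and, on each, the
   cost is continuous on a product of polytopes. *)

theory Submission
  imports Defs
begin

text \<open>Both passages between the problems start from arbitrary feasible points: one keeps the
  cost, the other does not increase it. Equality of the values, with \<open>+infinity\<close> in the
  infeasible case, and the transfer of optimality in both directions are then mere comparisons of
  costs. Attained minima enter only where a feasible mixed-integer problem is shown to have an
  optimal solution. \<open>Phi\<close> and \<open>Psi\<close> are there because the norm at a cell
  is summed over all pairs of arcs. With \<open>lam\<close> itself inside that norm, a pair with
  just one used arc would leave the norm of a single gate point as a spurious term;
  \<open>Phi\<close> and \<open>Psi\<close> copy \<open>lam\<close> onto the used pair
  alone.\<close>

lemma lp_norm_zero [simp]: "lp_norm p 0 = 0"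
  by (simp add: lp_norm_def infnorm_0)

lemma lp_norm_nonneg [simp]: "0 \<le> lp_norm p x"
  by (simp add: lp_norm_def infnorm_pos_le)

text \<open>The bases of \<open>powr\<close> are nonnegative but may be 0, where continuity needs a
  positive exponent. For finite \<open>p\<close> the bound \<open>1 \<le> p\<close> makes both
  exponents positive.\<close>

lemma continuous_on_lp_norm [continuous_intros]:
  fixes f :: "'a::topological_space \<Rightarrow> real ^ 'n"
  assumes p: "1 \<le> p" and f: "continuous_on S f"
  shows "continuous_on S (\<lambda>x. lp_norm p (f x))"
proof (cases "p = \<infinity>")
  case True
  then show ?thesis
    using f by (simp add: lp_norm_def continuous_on_infnorm)
next
  case False
  with p obtain q where q: "p = ereal q" "1 \<le> q"
    by (cases p) auto
  then show ?thesis
    using f by (auto simp: lp_norm_def intro!: continuous_on_powr' continuous_on_sum continuous_on_rabs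
        continuous_on_component continuous_on_const sum_nonneg)
qed

lemma finite_Ext_polytope: "polytope S \<Longrightarrow> finite (Ext S)"
  by (simp add: Ext_def finite_polyhedron_extreme_points polytope_imp_polyhedron)

lemma convex_hull_Ext_polytope: "polytope S \<Longrightarrow> convex hull (Ext S) = S"
  unfolding Ext_def
  by (metis Krein_Milman_Minkowski polytope_imp_compact polytope_imp_convex)

section \<open>Arcs of vertex lists and extraction of simple paths\<close>

lemma path_arcs_simps [simp]:
  "path_arcs [] = {}" "path_arcs [x] = {}"
  "path_arcs (x # y # zs) = insert (x, y) (path_arcs (y # zs))"
  by (auto simp: path_arcs_def)

lemma path_arcs_iff:
  "(i, j) \<in> path_arcs \<gamma> \<longleftrightarrow> (\<exists>r. Suc r < length \<gamma> \<and> i = \<gamma> ! r \<and> j = \<gamma> ! Suc r)"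
  unfolding path_arcs_def set_zip by (auto simp: nth_tl less_diff_conv)

lemma nth_path_arcs: "Suc r < length \<gamma> \<Longrightarrow> (\<gamma> ! r, \<gamma> ! Suc r) \<in> path_arcs \<gamma>"
  by (auto simp: path_arcs_iff)

lemma successively_iff_path_arcs:
  "successively R \<gamma> \<longleftrightarrow> (\<forall>(i, j) \<in> path_arcs \<gamma>. R i j)"
  by (induction R \<gamma> rule: successively.induct) auto

lemma path_arcs_append_Cons:
  "path_arcs (xs @ y # ys) = path_arcs (xs @ [y]) \<union> path_arcs (y # ys)"
proof (induction xs rule: induct_list012)
  case (2 x)
  show ?case by (cases ys) auto
qed auto

lemma path_arcs_snoc:
  "xs \<noteq> [] \<Longrightarrow> path_arcs (xs @ [y]) = insert (last xs, y) (path_arcs xs)"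
  by (induction xs rule: induct_list012) auto

text \<open>Distinctness is an invariant of the induction along the walk: a new vertex is appended,
  and a vertex already present cuts the list back to its earlier occurrence. The bound on
  \<open>set \<gamma>\<close> later places all cells of the path in \<open>{1..m}\<close>.\<close>

lemma rtrancl_imp_distinct_path:
  assumes "(a, b) \<in> R\<^sup>*"
  shows "\<exists>\<gamma>. \<gamma> \<noteq> [] \<and> hd \<gamma> = a \<and> last \<gamma> = b \<and> distinct \<gamma> \<and>
           path_arcs \<gamma> \<subseteq> R \<and> set \<gamma> \<subseteq> insert a (Range R)"
  using assms
proof (induction rule: rtrancl_induct)
  case base
  show ?case by (rule exI[of _ "[a]"]) simp
next
  case (step b c)
  then obtain \<gamma> where \<gamma>: "\<gamma> \<noteq> []" "hd \<gamma> = a" "last \<gamma> = b" "distinct \<gamma>"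
      "path_arcs \<gamma> \<subseteq> R" "set \<gamma> \<subseteq> insert a (Range R)"
    by blast
  show ?case
  proof (cases "c \<in> set \<gamma>")
    case True
    then obtain \<alpha> \<beta> where split: "\<gamma> = \<alpha> @ c # \<beta>"
      by (meson split_list)
    show ?thesis
      using \<gamma> unfolding split path_arcs_append_Cons[of \<alpha> c \<beta>]
      by (intro exI[of _ "\<alpha> @ [c]"]) (auto simp: hd_append)
  next
    case False
    then show ?thesis
      using \<gamma> step.hyps by (intro exI[of _ "\<gamma> @ [c]"]) (auto simp: path_arcs_snoc)
  qed
qed

section \<open>Flow conservation and collapsing sums\<close>

lemma sum_restrict_arcs:
  assumes "finite V" "A \<subseteq> V \<times> V"
  shows "(\<Sum>j | (i, j) \<in> A. f j) = (\<Sum>j\<in>V. if (i, j) \<in> A then f j else 0)"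
    and "(\<Sum>h | (h, i) \<in> A. f h) = (\<Sum>h\<in>V. if (h, i) \<in> A then f h else 0)"
proof -
  have "{j. (i, j) \<in> A} = {j \<in> V. (i, j) \<in> A}" "{h. (h, i) \<in> A} = {h \<in> V. (h, i) \<in> A}"
    using assms(2) by auto
  then show "(\<Sum>j | (i, j) \<in> A. f j) = (\<Sum>j\<in>V. if (i, j) \<in> A then f j else 0)"
    and "(\<Sum>h | (h, i) \<in> A. f h) = (\<Sum>h\<in>V. if (h, i) \<in> A then f h else 0)"
    by (simp_all add: sum.inter_filter[OF assms(1)])
qed

(* If t were unreachable, the set U of vertices reachable from s would have positive net outflow,
   although no positive arc leaves U. *)
lemma unit_flow_reaches_sink:
  fixes z :: "nat \<Rightarrow> nat \<Rightarrow> real"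
  assumes V: "finite V" "A \<subseteq> V \<times> V" and s: "s \<in> V" "s \<noteq> t"
    and z01: "\<And>i j. (i, j) \<in> A \<Longrightarrow> z i j \<in> {0, 1}"
    and source: "(\<Sum>j | (s, j) \<in> A. z s j) - (\<Sum>h | (h, s) \<in> A. z h s) = 1"
    and inner: "\<And>i. i \<in> V - {s, t} \<Longrightarrow>
        (\<Sum>j | (i, j) \<in> A. z i j) - (\<Sum>h | (h, i) \<in> A. z h i) = 0"
  shows "(s, t) \<in> {(i, j) \<in> A. z i j = 1}\<^sup>*"
proof (rule ccontr)
  let ?R = "{(i, j) \<in> A. z i j = 1}"
  assume unreach: "(s, t) \<notin> ?R\<^sup>*"
  define U where "U = {v \<in> V. (s, v) \<in> ?R\<^sup>*}"
  \<comment> \<open>Extending \<open>z\<close> by 0 off \<open>A\<close> turns sums over neighbours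
    into sums over the fixed set \<open>V\<close>, whose order can be exchanged.\<close>
  define x where "x i j = (if (i, j) \<in> A then z i j else 0)" for i j
  have x_nonneg: "0 \<le> x i j" for i j
    using z01[of i j] by (auto simp: x_def)
  have U: "U \<subseteq> V" "finite U" "s \<in> U" "t \<notin> U"
    using V s unreach by (auto simp: U_def)
  have outflow: "(\<Sum>j\<in>V. x i j) = (\<Sum>j\<in>U. x i j)" if "i \<in> U" for i
  proof (rule sum.mono_neutral_right)
    have "x i j = 0" if "j \<in> V - U" for j
    proof (rule ccontr)
      assume "x i j \<noteq> 0"
      then have "(i, j) \<in> ?R"
        using z01[of i j] by (auto simp: x_def split: if_splits)
      with \<open>i \<in> U\<close> that show False
        unfolding U_def by (auto intro: rtrancl_into_rtrancl)
    qed
    then show "\<forall>j\<in>V - U. x i j = 0" by blast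
  qed (use V U in auto)
  have net: "(\<Sum>j\<in>V. x i j) - (\<Sum>h\<in>V. x h i) = (if i = s then 1 else 0)" if "i \<in> U" for i
    using source inner[of i] that U
    unfolding x_def by (auto simp: sum_restrict_arcs[OF V])
  \<comment> \<open>Summed over \<open>U\<close>, the balances leave exactly the unit produced at
    \<open>s\<close>, since \<open>t\<close> lies outside \<open>U\<close>.\<close>
  have "(\<Sum>i\<in>U. \<Sum>h\<in>V. x h i) + 1 = (\<Sum>i\<in>U. \<Sum>j\<in>V. x i j)"
  proof -
    have "(\<Sum>i\<in>U. (\<Sum>j\<in>V. x i j) - (\<Sum>h\<in>V. x h i)) = (\<Sum>i\<in>U. if i = s then 1 else 0)"
      by (rule sum.cong[OF refl net])
    then show ?thesis
      using U by (simp add: sum_subtractf)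
  qed
  also have "\<dots> = (\<Sum>i\<in>U. \<Sum>j\<in>U. x i j)"
    using outflow by (rule sum.cong[OF refl])
  also have "\<dots> = (\<Sum>j\<in>U. \<Sum>i\<in>U. x i j)"
    by (rule sum.swap)
  \<comment> \<open>All outflow of \<open>U\<close> stays inside \<open>U\<close> and is therefore
    part of its inflow, so no surplus of 1 is possible.\<close>
  also have "\<dots> \<le> (\<Sum>j\<in>U. \<Sum>i\<in>V. x i j)"
    using V U x_nonneg by (intro sum_mono sum_mono2) auto
  finally show False by simp
qed

text \<open>The sum already contains \<open>f j + f k\<close>, so \<open>f j = 1\<close> leaves
  nothing for \<open>k\<close>. This converts the degree constraints into uniqueness of the entering
  and of the leaving arc.\<close>

lemma unique_one_if_sum_le_one:
  fixes f :: "'a \<Rightarrow> real"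
  assumes "finite J" "\<And>j. j \<in> J \<Longrightarrow> 0 \<le> f j" "sum f J \<le> 1"
    and "j \<in> J" "f j = 1" "k \<in> J" "k \<noteq> j"
  shows "f k = 0"
proof -
  have "sum f {j, k} \<le> sum f J"
    using assms by (intro sum_mono2) auto
  then show ?thesis
    using assms by (auto intro: antisym)
qed

lemma sum_single:
  assumes "finite J" "j \<in> J" "\<And>k. k \<in> J \<Longrightarrow> k \<noteq> j \<Longrightarrow> f k = 0"
  shows "sum f J = f j"
proof -
  have "sum f J = sum f {j}"
    by (rule sum.mono_neutral_right) (use assms in auto)
  then show ?thesis by simp
qed

text \<open>The path cost lists its two end cells separately and indexes by position, whereas the
  mixed-integer objective sums over cells. Distinctness makes the two forms agree.\<close>

lemma sum_ends_and_interior: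
  fixes f :: "nat \<Rightarrow> real"
  assumes "length \<gamma> = k + 2" "distinct \<gamma>"
  shows "f (\<gamma> ! 0) + (\<Sum>r = 1..k. f (\<gamma> ! r)) + f (\<gamma> ! Suc k) = (\<Sum>i\<in>set \<gamma>. f i)"
proof -
  have "(\<Sum>i\<in>set \<gamma>. f i) = (\<Sum>r\<le>Suc k. f (\<gamma> ! r))"
    using sum.reindex_bij_betw[OF bij_betw_nth[OF assms(2) refl refl], of f] assms(1)
    by (simp add: lessThan_Suc_atMost)
  also have "\<dots> = f (\<gamma> ! 0) + (\<Sum>r = 1..k. f (\<gamma> ! r)) + f (\<gamma> ! Suc k)"
    by (simp add: atMost_atLeast0 sum.atLeast_Suc_atMost[of 0])
  finally show ?thesis by simp
qed

section \<open>The two problems over a fixed subdivision\<close>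

locale spp_model =
  fixes m :: nat
    and P :: "nat \<Rightarrow> (real ^ 'n) set"
    and p :: "nat \<Rightarrow> ereal"
    and w :: "nat \<Rightarrow> real"
    and s t :: nat
    and xs xt :: "real ^ 'n"
  assumes subdivision: "polyhedral_subdivision m P"
    and p_ge_1: "\<And>i. i \<in> {1..m} \<Longrightarrow> 1 \<le> p i"
    and w_pos: "\<And>i. i \<in> {1..m} \<Longrightarrow> 0 < w i"
    and s_cell: "s \<in> {1..m}" and t_cell: "t \<in> {1..m}" and s_neq_t: "s \<noteq> t"
begin

abbreviation A where "A \<equiv> arcs m P"
abbreviation X where "X i j \<equiv> Ext (common_face P i j)"
abbreviation feasible_spp where "feasible_spp \<equiv> spp_feasible m P s t"
abbreviation cost_spp where "cost_spp \<equiv> spp_cost p w s t xs xt"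
abbreviation feasible_f2 where "feasible_f2 \<equiv> f2_feasible m P p s t xs xt"

lemma arcs_subset: "A \<subseteq> {1..m} \<times> {1..m}"
  by (auto simp: arcs_def edges_def doubleton_eq_iff)

lemma finite_arcs_from [simp]: "finite {j. (i, j) \<in> A}"
  by (rule finite_subset[of _ "{1..m}"]) (use arcs_subset in auto)

lemma finite_arcs_to [simp]: "finite {h. (h, i) \<in> A}"
  by (rule finite_subset[of _ "{1..m}"]) (use arcs_subset in auto)

lemma polytope_common_face:
  assumes "(i, j) \<in> A"
  shows "polytope (common_face P i j)"
proof -
  have "i \<in> {1..m}" "j \<in> {1..m}"
    using assms arcs_subset by auto
  then show ?thesis
    using subdivision face_of_polytope_polytope
    unfolding polyhedral_subdivision_def common_face_def by blast
qed

text \<open>Minkowski's theorem for polytopes. It translates between gate points and coefficients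
  \<open>lam\<close> in both directions: choosing coefficients for a path, and recognizing the point
  built from coefficients of sum 1 as a gate point.\<close>

lemma mem_common_face_iff:
  assumes "(i, j) \<in> A"
  shows "y \<in> common_face P i j \<longleftrightarrow>
    (\<exists>u. (\<forall>e\<in>X i j. 0 \<le> u e) \<and> sum u (X i j) = 1 \<and> (\<Sum>e\<in>X i j. u e *\<^sub>R e) = y)"
proof -
  note poly = polytope_common_face[OF assms]
  have "y \<in> common_face P i j \<longleftrightarrow> y \<in> convex hull X i j"
    unfolding convex_hull_Ext_polytope[OF poly] ..
  then show ?thesis
    unfolding convex_hull_finite[OF finite_Ext_polytope[OF poly]] by blast
qed

text \<open>As \<open>s\<close> and \<open>t\<close> differ, the list has at least two entries, so
  the natural number \<open>length \<gamma> - 2\<close> in the cost is not truncated.\<close>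

lemma simple_pathD:
  assumes "\<gamma> \<in> simple_paths m P s t"
  obtains k where "length \<gamma> = k + 2" "\<gamma> ! 0 = s" "\<gamma> ! Suc k = t" "distinct \<gamma>"
    "set \<gamma> \<subseteq> {1..m}" "path_arcs \<gamma> \<subseteq> A"
proof -
  have \<gamma>: "\<gamma> \<noteq> []" "hd \<gamma> = s" "last \<gamma> = t" "distinct \<gamma>" "set \<gamma> \<subseteq> {1..m}"
      "successively (\<lambda>i j. {i, j} \<in> edges m P) \<gamma>"
    using assms by (auto simp: simple_paths_def)
  obtain x y zs where "\<gamma> = x # y # zs"
    using \<gamma> s_neq_t by (metis last.simps list.sel(1) neq_Nil_conv)
  then have len: "length \<gamma> = length zs + 2" by simp
  have "\<gamma> ! 0 = s" "\<gamma> ! Suc (length zs) = t"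
    using \<gamma> len by (simp_all add: hd_conv_nth last_conv_nth)
  moreover have "path_arcs \<gamma> \<subseteq> A"
    using \<gamma>(6) by (auto simp: successively_iff_path_arcs arcs_def)
  ultimately show thesis
    using that len \<gamma> by blast
qed

lemma simple_path_interior_cell:
  assumes \<gamma>: "\<gamma> \<in> simple_paths m P s t" and r: "r \<in> {1..length \<gamma> - 2}"
  shows "\<gamma> ! r \<in> {1..m} - {s, t}"
proof -
  obtain k where k: "length \<gamma> = k + 2" "\<gamma> ! 0 = s" "\<gamma> ! Suc k = t" "distinct \<gamma>" "set \<gamma> \<subseteq> {1..m}"
    using simple_pathD[OF \<gamma>] by metis
  have "\<gamma> ! r \<noteq> \<gamma> ! 0" "\<gamma> ! r \<noteq> \<gamma> ! Suc k" "\<gamma> ! r \<in> set \<gamma>"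
    using k r by (auto simp: nth_eq_iff_index_eq)
  then show ?thesis
    using k by auto
qed

lemma weighted_path_sum:
  assumes "\<gamma> \<in> simple_paths m P s t"
  shows "(\<Sum>i\<in>set \<gamma>. w i * d i) =
    w s * d s + (\<Sum>r = 1..length \<gamma> - 2. w (\<gamma> ! r) * d (\<gamma> ! r)) + w t * d t"
proof -
  obtain k where "length \<gamma> = k + 2" "\<gamma> ! 0 = s" "\<gamma> ! Suc k = t" "distinct \<gamma>"
    using simple_pathD[OF assms] by metis
  then show ?thesis
    using sum_ends_and_interior[of \<gamma> k "\<lambda>i. w i * d i"] by simp
qed

subsection \<open>From a path to a solution of the mixed-integer problem\<close>

definition path_flow :: "nat list \<Rightarrow> nat \<Rightarrow> nat \<Rightarrow> real" where
  "path_flow \<gamma> i j = (if (i, j) \<in> path_arcs \<gamma> then 1 else 0)"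

text \<open>Each \<open>dv\<close> on a cell is exactly the lower bound that the model imposes on
  it, so the norm constraints hold with equality and the cost can be read off. The products are the
  bilinear expressions that \<open>rho\<close>, \<open>Phi\<close> and \<open>Psi\<close>
  linearize.\<close>

definition path_solution :: "nat list \<Rightarrow> (nat \<Rightarrow> nat \<Rightarrow> real ^ 'n \<Rightarrow> real) \<Rightarrow> 'n f2_sol" where
  "path_solution \<gamma> lam = \<lparr>
     dv = (\<lambda>i.
       if i = s then
         (\<Sum>j | (s, j) \<in> A. lp_norm (p s) ((\<Sum>e \<in> X s j. lam s j e *\<^sub>R e) - path_flow \<gamma> s j *\<^sub>R xs))
       else if i = t then
         (\<Sum>h | (h, t) \<in> A. lp_norm (p t) (path_flow \<gamma> h t *\<^sub>R xt - (\<Sum>e \<in> X h t. lam h t e *\<^sub>R e)))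
       else
         (\<Sum>h | (h, i) \<in> A. \<Sum>j | (i, j) \<in> A.
            lp_norm (p i) ((\<Sum>e \<in> X i j. (path_flow \<gamma> h i * lam i j e) *\<^sub>R e)
                         - (\<Sum>e \<in> X h i. (lam h i e * path_flow \<gamma> i j) *\<^sub>R e)))),
     zv = path_flow \<gamma>,
     lamv = lam,
     rhov = (\<lambda>h i j. path_flow \<gamma> h i * path_flow \<gamma> i j),
     Phiv = (\<lambda>h i j e. lam h i e * path_flow \<gamma> i j),
     Psiv = (\<lambda>h i j e. path_flow \<gamma> h i * lam i j e)\<rparr>"

text \<open>In a distinct list the tail of an arc determines its position and hence its head. The
  summand is arbitrary, so that flows, norms and whole inner sums collapse by the same rule.\<close>

lemma path_out_sum:
  assumes \<gamma>: "\<gamma> \<in> simple_paths m P s t" and r: "Suc r < length \<gamma>"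
    and f: "\<And>j. (\<gamma> ! r, j) \<in> A - path_arcs \<gamma> \<Longrightarrow> f j = 0"
  shows "(\<Sum>j | (\<gamma> ! r, j) \<in> A. f j) = f (\<gamma> ! Suc r)"
proof (rule sum_single)
  have d: "distinct \<gamma>" "path_arcs \<gamma> \<subseteq> A"
    by (rule simple_pathD[OF \<gamma>]; assumption)+
  show "\<gamma> ! Suc r \<in> {j. (\<gamma> ! r, j) \<in> A}"
    using nth_path_arcs[OF r] d by blast
  fix j assume j: "j \<in> {j. (\<gamma> ! r, j) \<in> A}" "j \<noteq> \<gamma> ! Suc r"
  have "(\<gamma> ! r, j) \<notin> path_arcs \<gamma>"
  proof
    assume "(\<gamma> ! r, j) \<in> path_arcs \<gamma>"
    then obtain q where "Suc q < length \<gamma>" "\<gamma> ! r = \<gamma> ! q" "j = \<gamma> ! Suc q"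
      unfolding path_arcs_iff by blast
    then show False
      using j r nth_eq_iff_index_eq[OF d(1), of r q] by simp
  qed
  then show "f j = 0"
    using f j by blast
qed simp

lemma path_in_sum:
  assumes \<gamma>: "\<gamma> \<in> simple_paths m P s t" and r: "Suc r < length \<gamma>"
    and f: "\<And>h. (h, \<gamma> ! Suc r) \<in> A - path_arcs \<gamma> \<Longrightarrow> f h = 0"
  shows "(\<Sum>h | (h, \<gamma> ! Suc r) \<in> A. f h) = f (\<gamma> ! r)"
proof (rule sum_single)
  have d: "distinct \<gamma>" "path_arcs \<gamma> \<subseteq> A"
    by (rule simple_pathD[OF \<gamma>]; assumption)+
  show "\<gamma> ! r \<in> {h. (h, \<gamma> ! Suc r) \<in> A}"
    using nth_path_arcs[OF r] d by blast
  fix h assume h: "h \<in> {h. (h, \<gamma> ! Suc r) \<in> A}" "h \<noteq> \<gamma> ! r"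
  have "(h, \<gamma> ! Suc r) \<notin> path_arcs \<gamma>"
  proof
    assume "(h, \<gamma> ! Suc r) \<in> path_arcs \<gamma>"
    then obtain q where "Suc q < length \<gamma>" "h = \<gamma> ! q" "\<gamma> ! Suc r = \<gamma> ! Suc q"
      unfolding path_arcs_iff by blast
    then show False
      using h r nth_eq_iff_index_eq[OF d(1), of "Suc r" "Suc q"] by simp
  qed
  then show "f h = 0"
    using f h by blast
qed simp

lemma path_arcs_cell_cases:
  assumes \<gamma>: "\<gamma> \<in> simple_paths m P s t" and i: "i \<notin> {s, t}"
  obtains (on) r where "r \<in> {1..length \<gamma> - 2}" "i = \<gamma> ! r"
    | (off) "i \<notin> set \<gamma>" "\<And>j. (i, j) \<notin> path_arcs \<gamma>" "\<And>h. (h, i) \<notin> path_arcs \<gamma>"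
proof (cases "i \<in> set \<gamma>")
  case True
  obtain k where k: "length \<gamma> = k + 2" "\<gamma> ! 0 = s" "\<gamma> ! Suc k = t"
    using simple_pathD[OF \<gamma>] by metis
  from True obtain r where r: "r < length \<gamma>" "i = \<gamma> ! r"
    by (auto simp: in_set_conv_nth)
  then have "r \<noteq> 0" "r \<noteq> Suc k"
    using k i by (intro notI; simp)+
  with r k show thesis by (intro on[of r]) auto
next
  case False
  then show thesis by (intro off) (auto simp: path_arcs_iff)
qed

lemma path_flow_values: "path_flow \<gamma> i j \<in> {0, 1}"
  by (simp add: path_flow_def)

lemma path_flow_ends:
  assumes \<gamma>: "\<gamma> \<in> simple_paths m P s t"
  shows "(\<Sum>j | (s, j) \<in> A. path_flow \<gamma> s j) = 1" "(\<Sum>h | (h, s) \<in> A. path_flow \<gamma> h s) = 0"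
    "(\<Sum>j | (t, j) \<in> A. path_flow \<gamma> t j) = 0" "(\<Sum>h | (h, t) \<in> A. path_flow \<gamma> h t) = 1"
proof -
  obtain k where k: "length \<gamma> = k + 2" "\<gamma> ! 0 = s" "\<gamma> ! Suc k = t" "distinct \<gamma>"
    using simple_pathD[OF \<gamma>] by metis
  have arc: "(\<gamma> ! r, \<gamma> ! Suc r) \<in> path_arcs \<gamma>" if "r \<le> k" for r
    using that k(1) by (simp add: nth_path_arcs)
  show "(\<Sum>j | (s, j) \<in> A. path_flow \<gamma> s j) = 1"
    using path_out_sum[OF \<gamma>, of 0 "path_flow \<gamma> s"] k arc[of 0] by (simp add: path_flow_def)
  show "(\<Sum>h | (h, t) \<in> A. path_flow \<gamma> h t) = 1"
    using path_in_sum[OF \<gamma>, of k "\<lambda>h. path_flow \<gamma> h t"] k arc[of k] by (simp add: path_flow_def)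
  have "(h, s) \<notin> path_arcs \<gamma>" for h
  proof
    assume "(h, s) \<in> path_arcs \<gamma>"
    then obtain r where "Suc r < length \<gamma>" "\<gamma> ! Suc r = \<gamma> ! 0"
      using k by (auto simp: path_arcs_iff)
    then show False
      using k nth_eq_iff_index_eq[of \<gamma> "Suc r" 0] by simp
  qed
  then show "(\<Sum>h | (h, s) \<in> A. path_flow \<gamma> h s) = 0"
    by (simp add: path_flow_def)
  have "(t, j) \<notin> path_arcs \<gamma>" for j
  proof
    assume "(t, j) \<in> path_arcs \<gamma>"
    then obtain r where "Suc r < length \<gamma>" "\<gamma> ! r = \<gamma> ! Suc k"
      using k by (auto simp: path_arcs_iff)
    then show False
      using k nth_eq_iff_index_eq[of \<gamma> r "Suc k"] by simp
  qed
  then show "(\<Sum>j | (t, j) \<in> A. path_flow \<gamma> t j) = 0"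
    by (simp add: path_flow_def)
qed

lemma path_flow_interior:
  assumes \<gamma>: "\<gamma> \<in> simple_paths m P s t" and r: "r \<in> {1..length \<gamma> - 2}"
  shows "(\<Sum>j | (\<gamma> ! r, j) \<in> A. path_flow \<gamma> (\<gamma> ! r) j) = 1"
    "(\<Sum>h | (h, \<gamma> ! r) \<in> A. path_flow \<gamma> h (\<gamma> ! r)) = 1"
proof -
  have "Suc r < length \<gamma>" "1 \<le> r"
    using r by auto
  note r = r this
  show "(\<Sum>j | (\<gamma> ! r, j) \<in> A. path_flow \<gamma> (\<gamma> ! r) j) = 1"
    using path_out_sum[OF \<gamma>, of r "path_flow \<gamma> (\<gamma> ! r)"] r nth_path_arcs[of r \<gamma>] by (simp add: path_flow_def)
  show "(\<Sum>h | (h, \<gamma> ! r) \<in> A. path_flow \<gamma> h (\<gamma> ! r)) = 1"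
    using path_in_sum[OF \<gamma>, of "r - 1" "\<lambda>h. path_flow \<gamma> h (\<gamma> ! r)"] r nth_path_arcs[of "r - 1" \<gamma>]
    by (simp add: path_flow_def)
qed

text \<open>Such a cell has either one used arc in and one out, or none at all. In the last two
  clauses a single used arc at \<open>i\<close> excludes the second alternative.\<close>

lemma path_flow_balance:
  assumes \<gamma>: "\<gamma> \<in> simple_paths m P s t" and i: "i \<notin> {s, t}"
  shows "(\<Sum>j | (i, j) \<in> A. path_flow \<gamma> i j) = (\<Sum>h | (h, i) \<in> A. path_flow \<gamma> h i)"
    "(\<Sum>j | (i, j) \<in> A. path_flow \<gamma> i j) \<le> 1"
    "\<And>h. (h, i) \<in> path_arcs \<gamma> \<Longrightarrow> (\<Sum>j | (i, j) \<in> A. path_flow \<gamma> i j) = 1"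
    "\<And>j. (i, j) \<in> path_arcs \<gamma> \<Longrightarrow> (\<Sum>h | (h, i) \<in> A. path_flow \<gamma> h i) = 1"
proof -
  let ?out = "\<Sum>j | (i, j) \<in> A. path_flow \<gamma> i j" and ?in = "\<Sum>h | (h, i) \<in> A. path_flow \<gamma> h i"
  have "?out = 1 \<and> ?in = 1 \<or> ?out = 0 \<and> ?in = 0 \<and> (\<forall>j. (i, j) \<notin> path_arcs \<gamma>) \<and> (\<forall>h. (h, i) \<notin> path_arcs \<gamma>)"
    by (rule path_arcs_cell_cases[OF \<gamma> i])
      (auto simp: path_flow_interior[OF \<gamma>] path_flow_def[of _ _ i] path_flow_def[of _ i])
  then show "?out = ?in" "?out \<le> 1"
    "\<And>h. (h, i) \<in> path_arcs \<gamma> \<Longrightarrow> ?out = 1" "\<And>j. (i, j) \<in> path_arcs \<gamma> \<Longrightarrow> ?in = 1"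
    by auto
qed

lemma path_coefficientsD:
  assumes lam: "path_coefficients m P \<gamma> y lam"
  shows "(i, j) \<in> path_arcs \<gamma> \<Longrightarrow> (\<Sum>e\<in>X i j. lam i j e *\<^sub>R e) = y i j"
    and "(i, j) \<in> A - path_arcs \<gamma> \<Longrightarrow> e \<in> X i j \<Longrightarrow> lam i j e = 0"
    and "(i, j) \<in> A \<Longrightarrow> (\<Sum>e\<in>X i j. lam i j e) = path_flow \<gamma> i j"
    and "(i, j) \<in> A \<Longrightarrow> e \<in> X i j \<Longrightarrow> 0 \<le> lam i j e"
proof -
  have on: "\<forall>e\<in>X i j. 0 \<le> lam i j e" "(\<Sum>e\<in>X i j. lam i j e) = 1" "(\<Sum>e\<in>X i j. lam i j e *\<^sub>R e) = y i j"
    if "(i, j) \<in> path_arcs \<gamma>" for i j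
    using lam that unfolding path_coefficients_def by blast+
  show off: "lam i j e = 0" if "(i, j) \<in> A - path_arcs \<gamma>" "e \<in> X i j" for i j e
    using lam that unfolding path_coefficients_def by blast
  show "(\<Sum>e\<in>X i j. lam i j e *\<^sub>R e) = y i j" if "(i, j) \<in> path_arcs \<gamma>"
    using on that by blast
  show "(\<Sum>e\<in>X i j. lam i j e) = path_flow \<gamma> i j" if "(i, j) \<in> A"
    using on(2) off that by (cases "(i, j) \<in> path_arcs \<gamma>") (auto simp: path_flow_def)
  show "0 \<le> lam i j e" if "(i, j) \<in> A" "e \<in> X i j"
    using on(1) off[of i j e] that by (cases "(i, j) \<in> path_arcs \<gamma>") auto
qed

lemma path_solution_feasible:
  assumes \<gamma>: "\<gamma> \<in> simple_paths m P s t" and lam: "path_coefficients m P \<gamma> y lam"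
  shows "feasible_f2 (path_solution \<gamma> lam)"
proof -
  note lamD = path_coefficientsD[OF lam]
  \<comment> \<open>Where the fixed factor of a product is nonzero, the flow factor sums to 1 over
    the neighbours and disappears. The four identities are the marginal constraints on
    \<open>Phi\<close>, \<open>Psi\<close> and, twice, \<open>rho\<close>.\<close>
  have out: "lam h i e * (\<Sum>j | (i, j) \<in> A. path_flow \<gamma> i j) = lam h i e"
    if "(h, i) \<in> A" "e \<in> X h i" "i \<notin> {s, t}" for h i e
    using that path_flow_balance(3)[OF \<gamma>, of i h] lamD(2)[of h i e]
    by (cases "(h, i) \<in> path_arcs \<gamma>") auto
  have inn: "(\<Sum>h | (h, i) \<in> A. path_flow \<gamma> h i) * lam i j e = lam i j e"
    if "(i, j) \<in> A" "e \<in> X i j" "i \<notin> {s, t}" for i j e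
    using that path_flow_balance(4)[OF \<gamma>, of i j] lamD(2)[of i j e]
    by (cases "(i, j) \<in> path_arcs \<gamma>") auto
  have zout: "path_flow \<gamma> h i * (\<Sum>j | (i, j) \<in> A. path_flow \<gamma> i j) = path_flow \<gamma> h i"
    if "i \<notin> {s, t}" for h i
    using that path_flow_balance(3)[OF \<gamma>, of i h]
    by (cases "(h, i) \<in> path_arcs \<gamma>") (auto simp: path_flow_def[of \<gamma> h i])
  have zin: "(\<Sum>h | (h, i) \<in> A. path_flow \<gamma> h i) * path_flow \<gamma> i j = path_flow \<gamma> i j"
    if "i \<notin> {s, t}" for i j
    using that path_flow_balance(4)[OF \<gamma>, of i j]
    by (cases "(i, j) \<in> path_arcs \<gamma>") (auto simp: path_flow_def[of \<gamma> i j])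
  have le_1: "(\<Sum>h | (h, i) \<in> A. path_flow \<gamma> h i) \<le> 1" "(\<Sum>j | (i, j) \<in> A. path_flow \<gamma> i j) \<le> 1" for i
    using path_flow_ends[OF \<gamma>] path_flow_balance(1,2)[OF \<gamma>, of i]
    by (cases "i = s"; cases "i = t"; auto)+
  have flow_nonneg: "0 \<le> path_flow \<gamma> i j" for i j
    by (simp add: path_flow_def)
  show ?thesis
    unfolding f2_feasible_def Let_def path_solution_def f2_sol.simps
  proof (intro conjI, goal_cases)
    case 1 show ?case using path_flow_ends[OF \<gamma>] by simp
  next
    case 2 show ?case using path_flow_balance(1)[OF \<gamma>] by simp
  next
    case 3 show ?case using path_flow_ends[OF \<gamma>] by simp
  next
    case 4 show ?case using le_1 by simp
  next
    case 5 show ?case using le_1 by simp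
  next
    case 6 show ?case by simp
  next
    case 7 show ?case by simp
  next
    case 8 show ?case using s_neq_t by simp
  next
    case 9 show ?case using lamD(3) by blast
  next
    case 10 show ?case by (simp add: sum_distrib_left[symmetric] zout)
  next
    case 11 show ?case by (simp add: sum_distrib_right[symmetric] zin)
  next
    case 12 show ?case by (simp add: sum_distrib_right[symmetric] lamD(3))
  next
    case 13 show ?case by (simp add: sum_distrib_left[symmetric] out)
  next
    case 14 show ?case by (simp add: sum_distrib_left[symmetric] lamD(3))
  next
    case 15 show ?case by (simp add: sum_distrib_right[symmetric] inn)
  next
    case 16 show ?case by (simp add: sum_nonneg)
  next
    case 17 show ?case using path_flow_values by blast
  next
    case 18 show ?case using lamD(4) by blast
  next
    case 19 show ?case using lamD(4) flow_nonneg by simp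
  qed
qed

text \<open>On a cell of the path every sum of norms collapses to the one term in the path cost; on
  any other cell all vectors inside the norms are 0.\<close>

lemma path_solution_cost:
  assumes \<gamma>: "\<gamma> \<in> simple_paths m P s t" and lam: "path_coefficients m P \<gamma> y lam"
  shows "f2_cost m w (path_solution \<gamma> lam) = cost_spp \<gamma> y"
proof -
  obtain k where k: "length \<gamma> = k + 2" "\<gamma> ! 0 = s" "\<gamma> ! Suc k = t" "set \<gamma> \<subseteq> {1..m}"
    using simple_pathD[OF \<gamma>] by metis
  note lamD = path_coefficientsD[OF lam]
  let ?d = "dv (path_solution \<gamma> lam)"
  have arc: "(\<gamma> ! q, \<gamma> ! Suc q) \<in> path_arcs \<gamma>" if "q \<le> k" for q
    using that k(1) by (simp add: nth_path_arcs)
  have flow_on: "path_flow \<gamma> (\<gamma> ! q) (\<gamma> ! Suc q) = 1"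
    and lam_on: "(\<Sum>e\<in>X (\<gamma> ! q) (\<gamma> ! Suc q). lam (\<gamma> ! q) (\<gamma> ! Suc q) e *\<^sub>R e) = y (\<gamma> ! q) (\<gamma> ! Suc q)"
    if "q \<le> k" for q
    using arc[OF that] lamD(1) by (auto simp: path_flow_def)
  have flow_off: "path_flow \<gamma> i j = 0" if "(i, j) \<in> A - path_arcs \<gamma>" for i j
    using that by (simp add: path_flow_def)
  have d_s: "?d s = lp_norm (p s) (y s (\<gamma> ! 1) - xs)"
    using path_out_sum[OF \<gamma>, of 0 "\<lambda>j. lp_norm (p s) ((\<Sum>e \<in> X s j. lam s j e *\<^sub>R e) - path_flow \<gamma> s j *\<^sub>R xs)"]
      k flow_on[of 0] lam_on[of 0] lamD(2)
    by (simp add: path_solution_def flow_off)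
  have d_t: "?d t = lp_norm (p t) (xt - y (\<gamma> ! k) t)"
    using path_in_sum[OF \<gamma>, of k "\<lambda>h. lp_norm (p t) (path_flow \<gamma> h t *\<^sub>R xt - (\<Sum>e \<in> X h t. lam h t e *\<^sub>R e))"]
      k flow_on[of k] lam_on[of k] lamD(2) s_neq_t
    by (simp add: path_solution_def flow_off)
  have d_interior: "?d (\<gamma> ! r) = lp_norm (p (\<gamma> ! r)) (y (\<gamma> ! r) (\<gamma> ! (r + 1)) - y (\<gamma> ! (r - 1)) (\<gamma> ! r))"
    if r: "r \<in> {1..k}" for r
  proof -
    \<comment> \<open>The rule for entering arcs is indexed by the tail of the arc, hence the
      predecessor position \<open>q\<close>.\<close>
    obtain q where q: "r = Suc q" "q \<le> k" "Suc r < length \<gamma>" "Suc q \<le> k"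
      using r k by (cases r) auto
    define i where "i = \<gamma> ! r"
    let ?f = "\<lambda>h j. lp_norm (p i) ((\<Sum>e \<in> X i j. (path_flow \<gamma> h i * lam i j e) *\<^sub>R e)
                         - (\<Sum>e \<in> X h i. (lam h i e * path_flow \<gamma> i j) *\<^sub>R e))"
    have "i \<noteq> s" "i \<noteq> t"
      using simple_path_interior_cell[OF \<gamma>, of r] r k by (auto simp: i_def)
    then have "?d i = (\<Sum>h | (h, \<gamma> ! Suc q) \<in> A. \<Sum>j | (\<gamma> ! r, j) \<in> A. ?f h j)"
      by (simp add: path_solution_def i_def q)
    also have "\<dots> = (\<Sum>j | (\<gamma> ! r, j) \<in> A. ?f (\<gamma> ! q) j)"
      by (rule path_in_sum[OF \<gamma>]) (use q in \<open>auto simp: i_def flow_off lamD(2)\<close>)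
    also have "\<dots> = ?f (\<gamma> ! q) (\<gamma> ! Suc r)"
      by (rule path_out_sum[OF \<gamma>]) (use q in \<open>auto simp: i_def flow_off lamD(2)\<close>)
    finally show ?thesis
      using flow_on[of q] flow_on[of "Suc q"] lam_on[of q] lam_on[of "Suc q"] q by (simp add: i_def)
  qed
  have d_off: "?d i = 0" if "i \<in> {1..m} - set \<gamma>" for i
  proof -
    have "s \<in> set \<gamma>" "t \<in> set \<gamma>"
      using k nth_mem[of 0 \<gamma>] nth_mem[of "Suc k" \<gamma>] by auto
    then have "i \<noteq> s" "i \<noteq> t"
      using that by auto
    moreover have "(i, j) \<notin> path_arcs \<gamma>" "(j, i) \<notin> path_arcs \<gamma>" for j
      using that by (auto simp: path_arcs_iff)
    ultimately show ?thesis
      by (auto simp: path_solution_def flow_off lamD(2) intro!: sum.neutral)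
  qed
  have "f2_cost m w (path_solution \<gamma> lam) = (\<Sum>i\<in>set \<gamma>. w i * ?d i)"
    unfolding f2_cost_def by (rule sum.mono_neutral_right) (use k d_off in auto)
  also have "\<dots> = cost_spp \<gamma> y"
    unfolding weighted_path_sum[OF \<gamma>] spp_cost_def Let_def
    using k by (simp add: d_s d_t d_interior)
  finally show ?thesis .
qed

lemma path_coefficients_exist:
  assumes "feasible_spp \<gamma> y"
  shows "\<exists>lam. path_coefficients m P \<gamma> y lam"
proof -
  have "\<gamma> \<in> simple_paths m P s t"
    and y: "\<And>i j. (i, j) \<in> path_arcs \<gamma> \<Longrightarrow> y i j \<in> common_face P i j"
    using assms unfolding spp_feasible_def by auto
  from this(1) have \<gamma>: "path_arcs \<gamma> \<subseteq> A"
    by (rule simple_pathD)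
  have "\<exists>u. (\<forall>e\<in>X i j. 0 \<le> u e) \<and> sum u (X i j) = 1 \<and> (\<Sum>e\<in>X i j. u e *\<^sub>R e) = y i j"
    if "(i, j) \<in> path_arcs \<gamma>" for i j
    using y[OF that] mem_common_face_iff[of i j "y i j"] that \<gamma> by blast
  then have "\<forall>i j. \<exists>u. (i, j) \<in> path_arcs \<gamma> \<longrightarrow>
      (\<forall>e\<in>X i j. 0 \<le> u e) \<and> sum u (X i j) = 1 \<and> (\<Sum>e\<in>X i j. u e *\<^sub>R e) = y i j"
    by blast
  then obtain u where u: "\<forall>i j. (i, j) \<in> path_arcs \<gamma> \<longrightarrow> (\<forall>e\<in>X i j. 0 \<le> u i j e) \<and>
      sum (u i j) (X i j) = 1 \<and> (\<Sum>e\<in>X i j. u i j e *\<^sub>R e) = y i j"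
    unfolding choice_iff by blast
  define lam where "lam i j = (if (i, j) \<in> path_arcs \<gamma> then u i j else (\<lambda>_. 0))" for i j
  have "path_coefficients m P \<gamma> y lam"
    unfolding path_coefficients_def
  proof (intro conjI; clarify)
    fix i j assume "(i, j) \<in> path_arcs \<gamma>"
    then show "(\<forall>e\<in>X i j. 0 \<le> lam i j e) \<and> sum (lam i j) (X i j) = 1 \<and>
        (\<Sum>e\<in>X i j. lam i j e *\<^sub>R e) = y i j"
      using u by (simp add: lam_def)
  qed (simp add: lam_def)
  then show ?thesis by blast
qed

subsection \<open>From a solution of the mixed-integer problem to a path\<close>

text \<open>The cost comparison is one-sided for two reasons: \<open>dv\<close> may exceed its lower
  bounds, and the support of \<open>zv\<close> may contain cycles away from the path, whose cells
  are charged in the objective too.\<close>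

lemma f2_feasible_gate_path:
  assumes F: "feasible_f2 S"
  obtains \<gamma> where "\<gamma> \<in> simple_paths m P s t" "path_arcs \<gamma> \<subseteq> {(i, j) \<in> A. zv S i j = 1}"
    "feasible_spp \<gamma> (gate_points P S)" "cost_spp \<gamma> (gate_points P S) \<le> f2_cost m w S"
proof -
  define d where "d = dv S"
  define z where "z = zv S"
  define lam where "lam = lamv S"
  define rho where "rho = rhov S"
  define Phi where "Phi = Phiv S"
  define Psi where "Psi = Psiv S"
  note F' = F[unfolded f2_feasible_def Let_def, folded d_def z_def lam_def rho_def Phi_def Psi_def]
  have source: "(\<Sum>j | (s, j) \<in> A. z s j) - (\<Sum>h | (h, s) \<in> A. z h s) = 1"
    using F' by (elim conjE)
  have inner: "\<forall>i \<in> {1..m} - {s, t}. (\<Sum>j | (i, j) \<in> A. z i j) - (\<Sum>h | (h, i) \<in> A. z h i) = 0"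
    using F' by (elim conjE)
  have in_le: "\<forall>i \<in> {1..m}. (\<Sum>h | (h, i) \<in> A. z h i) \<le> 1"
    using F' by (elim conjE)
  have out_le: "\<forall>i \<in> {1..m}. (\<Sum>j | (i, j) \<in> A. z i j) \<le> 1"
    using F' by (elim conjE)
  have d_s: "(\<Sum>j | (s, j) \<in> A. lp_norm (p s) ((\<Sum>e \<in> X s j. lam s j e *\<^sub>R e) - z s j *\<^sub>R xs)) \<le> d s"
    using F' by (elim conjE)
  have d_i: "\<forall>i \<in> {1..m} - {s, t}. (\<Sum>h | (h, i) \<in> A. \<Sum>j | (i, j) \<in> A.
      lp_norm (p i) ((\<Sum>e \<in> X i j. Psi h i j e *\<^sub>R e) - (\<Sum>e \<in> X h i. Phi h i j e *\<^sub>R e))) \<le> d i"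
    using F' by (elim conjE)
  have d_t: "(\<Sum>h | (h, t) \<in> A. lp_norm (p t) (z h t *\<^sub>R xt - (\<Sum>e \<in> X h t. lam h t e *\<^sub>R e))) \<le> d t"
    using F' by (elim conjE)
  have lam_sum: "\<forall>(i, j) \<in> A. (\<Sum>e \<in> X i j. lam i j e) = z i j"
    using F' by (elim conjE)
  have rho_in: "\<forall>i \<in> {1..m} - {s, t}. \<forall>h. (h, i) \<in> A \<longrightarrow> (\<Sum>j | (i, j) \<in> A. rho h i j) = z h i"
    using F' by (elim conjE)
  have rho_out: "\<forall>i \<in> {1..m} - {s, t}. \<forall>j. (i, j) \<in> A \<longrightarrow> (\<Sum>h | (h, i) \<in> A. rho h i j) = z i j"
    using F' by (elim conjE)
  have Phi_sum: "\<forall>i \<in> {1..m} - {s, t}. \<forall>h j. (h, i) \<in> A \<and> (i, j) \<in> A \<longrightarrow>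
      (\<Sum>e \<in> X h i. Phi h i j e) = rho h i j"
    using F' by (elim conjE)
  have Phi_lam: "\<forall>i \<in> {1..m} - {s, t}. \<forall>h. (h, i) \<in> A \<longrightarrow>
      (\<forall>e \<in> X h i. (\<Sum>j | (i, j) \<in> A. Phi h i j e) = lam h i e)"
    using F' by (elim conjE)
  have Psi_sum: "\<forall>i \<in> {1..m} - {s, t}. \<forall>h j. (h, i) \<in> A \<and> (i, j) \<in> A \<longrightarrow>
      (\<Sum>e \<in> X i j. Psi h i j e) = rho h i j"
    using F' by (elim conjE)
  have Psi_lam: "\<forall>i \<in> {1..m} - {s, t}. \<forall>j. (i, j) \<in> A \<longrightarrow>
      (\<forall>e \<in> X i j. (\<Sum>h | (h, i) \<in> A. Psi h i j e) = lam i j e)"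
    using F' by (elim conjE)
  have d_nonneg: "\<forall>i \<in> {1..m}. 0 \<le> d i"
    using F' by (elim conjE)
  have z01: "\<forall>(i, j) \<in> A. z i j \<in> {0, 1}"
    using F' by (elim conjE)
  have lam_nonneg: "\<forall>(i, j) \<in> A. \<forall>e \<in> X i j. 0 \<le> lam i j e"
    using F' by (elim conjE)
  have nonneg: "\<forall>i \<in> {1..m} - {s, t}. \<forall>h j. (h, i) \<in> A \<and> (i, j) \<in> A \<longrightarrow>
      0 \<le> rho h i j \<and> (\<forall>e \<in> X h i. 0 \<le> Phi h i j e) \<and> (\<forall>e \<in> X i j. 0 \<le> Psi h i j e)"
    using F' by (elim conjE)

  have "(s, t) \<in> {(i, j) \<in> A. z i j = 1}\<^sup>*"
  proof (rule unit_flow_reaches_sink[OF _ arcs_subset s_cell s_neq_t _ source])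
    show "z i j \<in> {0, 1}" if "(i, j) \<in> A" for i j
      using z01 that by blast
  qed (use inner in auto)
  then obtain \<gamma> where \<gamma>: "\<gamma> \<noteq> []" "hd \<gamma> = s" "last \<gamma> = t" "distinct \<gamma>"
      "path_arcs \<gamma> \<subseteq> {(i, j) \<in> A. z i j = 1}"
      "set \<gamma> \<subseteq> insert s (Range {(i, j) \<in> A. z i j = 1})"
    using rtrancl_imp_distinct_path by meson
  have "set \<gamma> \<subseteq> {1..m}"
    using \<gamma>(6) arcs_subset s_cell by blast
  moreover have "successively (\<lambda>i j. {i, j} \<in> edges m P) \<gamma>"
    using \<gamma>(5) unfolding successively_iff_path_arcs arcs_def by blast
  ultimately have path: "\<gamma> \<in> simple_paths m P s t"
    using \<gamma> by (simp add: simple_paths_def)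
  have arcs: "path_arcs \<gamma> \<subseteq> {(i, j) \<in> A. zv S i j = 1}"
    using \<gamma>(5) by (simp add: z_def)
  let ?y = "gate_points P S"
  have y: "?y i j = (\<Sum>e \<in> X i j. lam i j e *\<^sub>R e)" for i j
    by (simp add: gate_points_def lam_def)
  have "?y i j \<in> common_face P i j" if "(i, j) \<in> path_arcs \<gamma>" for i j
  proof -
    have ij: "(i, j) \<in> A" "z i j = 1"
      using that \<gamma>(5) by auto
    then have "\<forall>e\<in>X i j. 0 \<le> lam i j e" "sum (lam i j) (X i j) = 1"
      using lam_nonneg lam_sum by auto
    then show ?thesis
      unfolding mem_common_face_iff[OF ij(1)] y by blast
  qed
  then have feasible: "feasible_spp \<gamma> ?y"
    using path by (auto simp: spp_feasible_def)

  obtain k where k: "length \<gamma> = k + 2" "\<gamma> ! 0 = s" "\<gamma> ! Suc k = t" "set \<gamma> \<subseteq> {1..m}"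
    using simple_pathD[OF path] by metis
  have z_arc: "(\<gamma> ! q, \<gamma> ! Suc q) \<in> A" "z (\<gamma> ! q) (\<gamma> ! Suc q) = 1" if "q \<le> k" for q
    using nth_path_arcs[of q \<gamma>] that k(1) \<gamma>(5) by auto
  \<comment> \<open>All three bounds keep the summand that belongs to the path and drop the other
    norms. At the end cells, \<open>z = 1\<close> on the path arc turns the scaled endpoint into
    \<open>xs\<close> or \<open>xt\<close>.\<close>
  have bound_s: "lp_norm (p s) (?y s (\<gamma> ! 1) - xs) \<le> d s"
  proof -
    have "lp_norm (p s) ((\<Sum>e \<in> X s (\<gamma> ! 1). lam s (\<gamma> ! 1) e *\<^sub>R e) - z s (\<gamma> ! 1) *\<^sub>R xs)
        \<le> (\<Sum>j | (s, j) \<in> A. lp_norm (p s) ((\<Sum>e \<in> X s j. lam s j e *\<^sub>R e) - z s j *\<^sub>R xs))"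
      using z_arc[of 0] k by (intro member_le_sum) auto
    then show ?thesis
      using d_s z_arc[of 0] k by (simp add: y)
  qed
  have bound_t: "lp_norm (p t) (xt - ?y (\<gamma> ! k) t) \<le> d t"
  proof -
    have "lp_norm (p t) (z (\<gamma> ! k) t *\<^sub>R xt - (\<Sum>e \<in> X (\<gamma> ! k) t. lam (\<gamma> ! k) t e *\<^sub>R e))
        \<le> (\<Sum>h | (h, t) \<in> A. lp_norm (p t) (z h t *\<^sub>R xt - (\<Sum>e \<in> X h t. lam h t e *\<^sub>R e)))"
      using z_arc[of k] k
        member_le_sum[of "\<gamma> ! k" "{h. (h, t) \<in> A}"
          "\<lambda>h. lp_norm (p t) (z h t *\<^sub>R xt - (\<Sum>e \<in> X h t. lam h t e *\<^sub>R e))"]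
      by simp
    then show ?thesis
      using d_t z_arc[of k] k by (simp add: y)
  qed
  have bound_i: "lp_norm (p (\<gamma> ! r)) (?y (\<gamma> ! r) (\<gamma> ! (r + 1)) - ?y (\<gamma> ! (r - 1)) (\<gamma> ! r)) \<le> d (\<gamma> ! r)"
    if r: "r \<in> {1..k}" for r
  proof -
    define h i j where "h = \<gamma> ! (r - 1)" and "i = \<gamma> ! r" and "j = \<gamma> ! (r + 1)"
    have i: "i \<in> {1..m} - {s, t}" "i \<in> {1..m}"
      using simple_path_interior_cell[OF path, of r] r k by (auto simp: i_def)
    have hi: "(h, i) \<in> A" "z h i = 1" and ij: "(i, j) \<in> A" "z i j = 1"
      using z_arc[of "r - 1"] z_arc[of r] r by (auto simp: h_def i_def j_def)
    \<comment> \<open>The unit of flow through cell i enters by h and leaves by j, so rho, Phi and Psi vanish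
      on every other pair of arcs at i and the marginals of Phi and Psi reduce to one term.\<close>
    have z_nonneg: "0 \<le> z a b" if "(a, b) \<in> A" for a b
      using z01 that by fastforce
    have z_out: "z i j' = 0" if "(i, j') \<in> A" "j' \<noteq> j" for j'
      by (rule unique_one_if_sum_le_one[of "{j. (i, j) \<in> A}" "z i" j])
        (use out_le i ij that z_nonneg in auto)
    have z_in: "z h' i = 0" if "(h', i) \<in> A" "h' \<noteq> h" for h'
      by (rule unique_one_if_sum_le_one[of "{h. (h, i) \<in> A}" "\<lambda>h. z h i" h])
        (use in_le i hi that z_nonneg in auto)
    \<comment> \<open>A nonnegative \<open>rho\<close> is at most each of its marginals, so a zero
      of \<open>z\<close> on either arc of the pair forces it to 0.\<close>
    have rho_le_out: "rho h' i j' \<le> z i j'" if "(h', i) \<in> A" "(i, j') \<in> A" for h' j'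
      using member_le_sum[of h' "{h. (h, i) \<in> A}" "\<lambda>h. rho h i j'"] rho_out nonneg i that by auto
    have rho_le_in: "rho h' i j' \<le> z h' i" if "(h', i) \<in> A" "(i, j') \<in> A" for h' j'
      using member_le_sum[of j' "{j. (i, j) \<in> A}" "rho h' i"] rho_in nonneg i that by auto
    have Phi0: "Phi h i j' e = 0" if "(i, j') \<in> A" "j' \<noteq> j" "e \<in> X h i" for j' e
    proof -
      have "rho h i j' = 0"
        using rho_le_out[of h j'] z_out[of j'] nonneg i hi that by fastforce
      then have "sum (Phi h i j') (X h i) = 0"
        using Phi_sum i hi that by simp
      then show ?thesis
        using nonneg i hi that finite_Ext_polytope[OF polytope_common_face[OF hi(1)]]
        by (simp add: sum_nonneg_eq_0_iff)
    qed
    have Psi0: "Psi h' i j e = 0" if "(h', i) \<in> A" "h' \<noteq> h" "e \<in> X i j" for h' e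
    proof -
      have "rho h' i j = 0"
        using rho_le_in[of h' j] z_in[of h'] nonneg i ij that by fastforce
      then have "sum (Psi h' i j) (X i j) = 0"
        using Psi_sum i ij that by simp
      then show ?thesis
        using nonneg i ij that finite_Ext_polytope[OF polytope_common_face[OF ij(1)]]
        by (simp add: sum_nonneg_eq_0_iff)
    qed
    have Phi: "Phi h i j e = lam h i e" if "e \<in> X h i" for e
      using sum_single[of "{j. (i, j) \<in> A}" j "\<lambda>j. Phi h i j e"] Phi_lam Phi0 i hi ij that by auto
    have Psi: "Psi h i j e = lam i j e" if "e \<in> X i j" for e
      using sum_single[of "{h. (h, i) \<in> A}" h "\<lambda>h. Psi h i j e"] Psi_lam Psi0 i hi ij that by auto
    let ?f = "\<lambda>h j. lp_norm (p i) ((\<Sum>e \<in> X i j. Psi h i j e *\<^sub>R e) - (\<Sum>e \<in> X h i. Phi h i j e *\<^sub>R e))"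
    have "lp_norm (p i) (?y i j - ?y h i) = ?f h j"
      by (simp add: y Phi Psi)
    also have "\<dots> \<le> (\<Sum>j | (i, j) \<in> A. ?f h j)"
      using member_le_sum[of j "{j. (i, j) \<in> A}" "?f h"] ij by simp
    also have "\<dots> \<le> (\<Sum>h | (h, i) \<in> A. \<Sum>j | (i, j) \<in> A. ?f h j)"
      using member_le_sum[of h "{h. (h, i) \<in> A}" "\<lambda>h. \<Sum>j | (i, j) \<in> A. ?f h j"] hi
      by (simp add: sum_nonneg)
    also have "\<dots> \<le> d i"
      using d_i i by blast
    finally show ?thesis
      by (simp add: h_def i_def j_def)
  qed
  have w_nonneg: "0 \<le> w i" if "i \<in> {1..m}" for i
    using w_pos[OF that] by simp
  have "cost_spp \<gamma> ?y \<le> (\<Sum>i\<in>set \<gamma>. w i * d i)"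
    unfolding weighted_path_sum[OF path] spp_cost_def Let_def
  proof (intro add_mono sum_mono mult_left_mono)
    fix r assume r: "r \<in> {1..length \<gamma> - 2}"
    show "lp_norm (p (\<gamma> ! r)) (?y (\<gamma> ! r) (\<gamma> ! (r + 1)) - ?y (\<gamma> ! (r - 1)) (\<gamma> ! r)) \<le> d (\<gamma> ! r)"
      using bound_i r k by simp
    show "0 \<le> w (\<gamma> ! r)"
      using w_nonneg simple_path_interior_cell[OF path r] by simp
  qed (use bound_s bound_t k w_nonneg s_cell t_cell in simp_all)
  \<comment> \<open>Cells off the path, those on cycles included, only add nonnegative
    terms.\<close>
  also have "\<dots> \<le> f2_cost m w S"
    unfolding f2_cost_def d_def[symmetric]
    using k d_nonneg w_nonneg by (intro sum_mono2) auto
  finally show thesis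
    using that path arcs feasible by blast
qed

subsection \<open>Existence of shortest paths\<close>

lemma spp_cost_cong:
  assumes \<gamma>: "\<gamma> \<in> simple_paths m P s t"
    and eq: "\<And>i j. (i, j) \<in> path_arcs \<gamma> \<Longrightarrow> y i j = y' i j"
  shows "cost_spp \<gamma> y = cost_spp \<gamma> y'"
proof -
  obtain k where k: "length \<gamma> = k + 2" "\<gamma> ! 0 = s" "\<gamma> ! Suc k = t"
    using simple_pathD[OF \<gamma>] by metis
  have y: "y (\<gamma> ! q) (\<gamma> ! Suc q) = y' (\<gamma> ! q) (\<gamma> ! Suc q)" if "q \<le> k" for q
    using that k by (intro eq nth_path_arcs) simp
  have "y (\<gamma> ! r) (\<gamma> ! (r + 1)) = y' (\<gamma> ! r) (\<gamma> ! (r + 1))"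
       "y (\<gamma> ! (r - 1)) (\<gamma> ! r) = y' (\<gamma> ! (r - 1)) (\<gamma> ! r)" if "r \<in> {1..k}" for r
    using that y[of r] y[of "r - 1"] by auto
  then show ?thesis
    unfolding spp_cost_def Let_def using k y[of 0] y[of k] by simp
qed

lemma optimal_gate_points_exist:
  assumes feas: "feasible_spp \<gamma> y0"
  shows "\<exists>y. feasible_spp \<gamma> y \<and> (\<forall>y'. feasible_spp \<gamma> y' \<longrightarrow> cost_spp \<gamma> y \<le> cost_spp \<gamma> y')"
proof -
  have \<gamma>: "\<gamma> \<in> simple_paths m P s t"
    using feas by (simp add: spp_feasible_def)
  obtain k where k: "length \<gamma> = k + 2" "set \<gamma> \<subseteq> {1..m}" "path_arcs \<gamma> \<subseteq> A"
    using simple_pathD[OF \<gamma>] by metis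
  \<comment> \<open>Gate points off the path are irrelevant; pinning them to 0 makes the feasible set a product
    of compact sets.\<close>
  define B where "B = (\<lambda>(i, j). if (i, j) \<in> path_arcs \<gamma> then common_face P i j else {0})"
  define K where "K = PiE UNIV B"
  define pin where "pin y = (\<lambda>(i, j). if (i, j) \<in> path_arcs \<gamma> then y i j else 0)"
    for y :: "nat \<Rightarrow> nat \<Rightarrow> real ^ 'n"
  have pin: "pin y \<in> K" "cost_spp \<gamma> (curry (pin y)) = cost_spp \<gamma> y" if "feasible_spp \<gamma> y" for y
  proof -
    show "pin y \<in> K"
      using that by (auto simp: K_def B_def pin_def spp_feasible_def split: prod.splits)
    show "cost_spp \<gamma> (curry (pin y)) = cost_spp \<gamma> y"
      by (rule spp_cost_cong[OF \<gamma>]) (simp add: pin_def)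
  qed
  have "compact (B a)" for a
    using k(3) polytope_common_face polytope_imp_compact
    by (cases a) (auto simp: B_def)
  \<comment> \<open>Tychonoff's theorem. Gate assignments are uncurried to functions on pairs so
    that \<open>K\<close> is a single product; \<open>curry\<close> leads back to the form used in
    the cost.\<close>
  then have "compactin (product_topology (\<lambda>_. euclidean) UNIV) K"
    unfolding K_def compactin_PiE by simp
  then have "compact K"
    by (simp add: euclidean_product_topology)
  have p: "1 \<le> p s" "1 \<le> p t" "\<And>r. r \<in> {1..length \<gamma> - 2} \<Longrightarrow> 1 \<le> p (\<gamma> ! r)"
    using p_ge_1 s_cell t_cell simple_path_interior_cell[OF \<gamma>] by auto
  have coord: "continuous_on K (\<lambda>g. curry g i j)" for i j
    unfolding curry_def by (rule continuous_on_subset[OF continuous_on_product_coordinates]) simp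
  have "continuous_on K (\<lambda>g. cost_spp \<gamma> (curry g))"
    unfolding spp_cost_def Let_def
    by (intro continuous_on_add continuous_on_mult_left continuous_on_sum continuous_on_lp_norm p
        continuous_on_diff coord continuous_on_const)
  then obtain g where g: "g \<in> K" "\<And>g'. g' \<in> K \<Longrightarrow> cost_spp \<gamma> (curry g) \<le> cost_spp \<gamma> (curry g')"
    using continuous_attains_inf[OF \<open>compact K\<close>] pin(1)[OF feas] by blast
  have "feasible_spp \<gamma> (curry g)"
    unfolding spp_feasible_def
  proof (intro conjI \<gamma>; clarify)
    fix i j assume "(i, j) \<in> path_arcs \<gamma>"
    moreover have "g (i, j) \<in> B (i, j)"
      using g(1) by (auto simp: K_def)
    ultimately show "curry g i j \<in> common_face P i j"
      by (simp add: B_def)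
  qed
  moreover have "cost_spp \<gamma> (curry g) \<le> cost_spp \<gamma> y'" if "feasible_spp \<gamma> y'" for y'
    using g(2)[OF pin(1)[OF that]] pin(2)[OF that] by simp
  ultimately show ?thesis by blast
qed

lemma finite_simple_paths: "finite (simple_paths m P s t)"
  by (rule finite_subset[OF _ finite_subset_distinct[of "{1..m}"]]) (auto simp: simple_paths_def)

lemma spp_optimal_exists:
  assumes "feasible_spp \<gamma>0 y0"
  shows "\<exists>\<gamma> y. spp_optimal m P p w s t xs xt \<gamma> y"
proof -
  define G where "G = {\<gamma>. \<exists>y. feasible_spp \<gamma> y}"
  have "finite G" "G \<noteq> {}"
    using assms finite_subset[OF _ finite_simple_paths, of G] by (auto simp: G_def spp_feasible_def)
  have "\<forall>\<gamma>. \<exists>y. \<gamma> \<in> G \<longrightarrow>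
      feasible_spp \<gamma> y \<and> (\<forall>y'. feasible_spp \<gamma> y' \<longrightarrow> cost_spp \<gamma> y \<le> cost_spp \<gamma> y')"
    using optimal_gate_points_exist unfolding G_def by blast
  \<comment> \<open>With the best gate points recorded for each path, only a choice within the
    finite set \<open>G\<close> remains.\<close>
  then obtain Y where Y: "\<And>\<gamma>. \<gamma> \<in> G \<Longrightarrow> feasible_spp \<gamma> (Y \<gamma>)"
      "\<And>\<gamma> y'. \<gamma> \<in> G \<Longrightarrow> feasible_spp \<gamma> y' \<Longrightarrow> cost_spp \<gamma> (Y \<gamma>) \<le> cost_spp \<gamma> y'"
    unfolding choice_iff by blast
  obtain \<gamma> where \<gamma>: "\<gamma> \<in> G" "\<And>\<gamma>'. \<gamma>' \<in> G \<Longrightarrow> cost_spp \<gamma> (Y \<gamma>) \<le> cost_spp \<gamma>' (Y \<gamma>')"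
    using arg_min_if_finite(1)[OF \<open>finite G\<close> \<open>G \<noteq> {}\<close>, of "\<lambda>\<gamma>. cost_spp \<gamma> (Y \<gamma>)"]
      arg_min_least[OF \<open>finite G\<close> \<open>G \<noteq> {}\<close>, of _ "\<lambda>\<gamma>. cost_spp \<gamma> (Y \<gamma>)"] by blast
  have "cost_spp \<gamma> (Y \<gamma>) \<le> cost_spp \<gamma>' y'" if "feasible_spp \<gamma>' y'" for \<gamma>' y'
  proof -
    have "\<gamma>' \<in> G"
      using that by (auto simp: G_def)
    then show ?thesis
      using \<gamma>(2) Y(2) that order_trans by blast
  qed
  then show ?thesis
    using \<gamma>(1) Y(1) unfolding spp_optimal_def by blast
qed

subsection \<open>Equivalence of the two problems\<close>

lemma path_solution_of_feasible:
  assumes "feasible_spp \<gamma> y" "path_coefficients m P \<gamma> y lam"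
  shows "feasible_f2 (path_solution \<gamma> lam)" "f2_cost m w (path_solution \<gamma> lam) = cost_spp \<gamma> y"
  using assms path_solution_feasible path_solution_cost by (auto simp: spp_feasible_def)

lemma values_eq: "f2_value m P p w s t xs xt = spp_value m P p w s t xs xt"
proof (rule antisym)
  show "f2_value m P p w s t xs xt \<le> spp_value m P p w s t xs xt"
    unfolding spp_value_def
  proof (rule INF_greatest, clarify)
    fix \<gamma> y assume y: "feasible_spp \<gamma> y"
    obtain lam where "path_coefficients m P \<gamma> y lam"
      using path_coefficients_exist[OF y] by blast
    from path_solution_of_feasible[OF y this]
    show "f2_value m P p w s t xs xt \<le> ereal (cost_spp \<gamma> y)"
      unfolding f2_value_def by (metis INF_lower mem_Collect_eq)
  qed
  show "spp_value m P p w s t xs xt \<le> f2_value m P p w s t xs xt"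
    unfolding f2_value_def
  proof (rule INF_greatest, clarify)
    fix S assume "feasible_f2 S"
    then obtain \<gamma> where \<gamma>: "feasible_spp \<gamma> (gate_points P S)"
        "cost_spp \<gamma> (gate_points P S) \<le> f2_cost m w S"
      by (rule f2_feasible_gate_path)
    have "spp_value m P p w s t xs xt \<le> ereal (cost_spp \<gamma> (gate_points P S))"
      unfolding spp_value_def by (rule INF_lower2[of "(\<gamma>, gate_points P S)"]) (use \<gamma> in auto)
    then show "spp_value m P p w s t xs xt \<le> ereal (f2_cost m w S)"
      using \<gamma>(2) by (meson ereal_less_eq(3) order_trans)
  qed
qed

text \<open>The cost of the constructed solution is that of the optimal path, hence at most that of
  the path extracted from any competitor \<open>S\<close>, hence at most that of
  \<open>S\<close>.\<close>

lemma path_solution_optimal: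
  assumes opt: "spp_optimal m P p w s t xs xt \<gamma> y" and lam: "path_coefficients m P \<gamma> y lam"
  shows "f2_optimal m P p w s t xs xt (path_solution \<gamma> lam)"
proof -
  have feas: "feasible_spp \<gamma> y"
    using opt by (simp add: spp_optimal_def)
  have "f2_cost m w (path_solution \<gamma> lam) \<le> f2_cost m w S" if S: "feasible_f2 S" for S
  proof -
    obtain \<gamma>' where "feasible_spp \<gamma>' (gate_points P S)" "cost_spp \<gamma>' (gate_points P S) \<le> f2_cost m w S"
      using f2_feasible_gate_path[OF S] by metis
    then show ?thesis
      using opt path_solution_of_feasible(2)[OF feas lam] unfolding spp_optimal_def
      by (metis order_trans)
  qed
  then show ?thesis
    using path_solution_of_feasible(1)[OF feas lam] by (simp add: f2_optimal_def)
qed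

text \<open>The minimum is imported from the path problem: the variables \<open>dv\<close> are
  unbounded above, so compactness is used on the gate points instead.\<close>

lemma f2_optimal_exists:
  assumes "feasible_f2 S"
  shows "\<exists>S. f2_optimal m P p w s t xs xt S"
proof -
  obtain \<gamma>0 where "feasible_spp \<gamma>0 (gate_points P S)"
    using f2_feasible_gate_path[OF assms] by metis
  then obtain \<gamma> y where opt: "spp_optimal m P p w s t xs xt \<gamma> y"
    using spp_optimal_exists by blast
  then obtain lam where "path_coefficients m P \<gamma> y lam"
    using path_coefficients_exist unfolding spp_optimal_def by blast
  then show ?thesis
    using path_solution_optimal[OF opt] by blast
qed

text \<open>The extracted path costs at most as much as \<open>S\<close>, and \<open>S\<close> at
  most as much as the solution built from any competing path, which has that path's cost.\<close>

lemma f2_optimal_gate_path: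
  assumes opt: "f2_optimal m P p w s t xs xt S"
  shows "\<exists>\<gamma> \<in> simple_paths m P s t. path_arcs \<gamma> \<subseteq> {(i, j) \<in> A. zv S i j = 1} \<and>
    spp_optimal m P p w s t xs xt \<gamma> (gate_points P S)"
proof -
  have "feasible_f2 S"
    using opt by (simp add: f2_optimal_def)
  then obtain \<gamma> where \<gamma>: "\<gamma> \<in> simple_paths m P s t" "path_arcs \<gamma> \<subseteq> {(i, j) \<in> A. zv S i j = 1}"
    "feasible_spp \<gamma> (gate_points P S)" "cost_spp \<gamma> (gate_points P S) \<le> f2_cost m w S"
    by (rule f2_feasible_gate_path)
  have "cost_spp \<gamma> (gate_points P S) \<le> cost_spp \<gamma>' y'" if y': "feasible_spp \<gamma>' y'" for \<gamma>' y'
  proof -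
    obtain lam where "path_coefficients m P \<gamma>' y' lam"
      using path_coefficients_exist[OF y'] by blast
    from path_solution_of_feasible[OF y' this] show ?thesis
      using \<gamma>(4) opt unfolding f2_optimal_def by (metis order_trans)
  qed
  then show ?thesis
    using \<gamma> unfolding spp_optimal_def by blast
qed

end

theorem theorem14:
  fixes m :: nat
    and P :: "nat \<Rightarrow> (real ^ 'n) set"
    and p :: "nat \<Rightarrow> ereal"
    and w :: "nat \<Rightarrow> real"
    and s t :: nat
    and xs xt :: "real ^ 'n"
  assumes "polyhedral_subdivision m P"
    and "\<And>i. i \<in> {1..m} \<Longrightarrow> 1 \<le> p i"
    and "\<And>i. i \<in> {1..m} \<Longrightarrow> 0 < w i"
    and "s \<in> {1..m}" and "t \<in> {1..m}" and "s \<noteq> t"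
    and "xs \<in> P s" and "xt \<in> P t"
  shows "f2_value m P p w s t xs xt = spp_value m P p w s t xs xt
    \<and> ((\<exists>S. f2_feasible m P p s t xs xt S) \<longrightarrow> (\<exists>S. f2_optimal m P p w s t xs xt S))
    \<and> (\<forall>\<gamma> y. spp_optimal m P p w s t xs xt \<gamma> y \<longrightarrow>
         (\<exists>lam. path_coefficients m P \<gamma> y lam) \<and>
         (\<forall>lam. path_coefficients m P \<gamma> y lam \<longrightarrow>
            (\<exists>S. f2_optimal m P p w s t xs xt S \<and>
                 (\<forall>(i, j) \<in> arcs m P. zv S i j = (if (i, j) \<in> path_arcs \<gamma> then 1 else 0)) \<and>
                 lamv S = lam)))
    \<and> (\<forall>S. f2_optimal m P p w s t xs xt S \<longrightarrow>
         (\<exists>\<gamma> \<in> simple_paths m P s t.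
            path_arcs \<gamma> \<subseteq> {(i, j) \<in> arcs m P. zv S i j = 1} \<and>
            spp_optimal m P p w s t xs xt \<gamma> (gate_points P S)))"
proof -
  interpret spp_model m P p w s t xs xt
    using assms by unfold_locales auto
  show ?thesis
  proof (intro conjI allI impI)
    show "f2_value m P p w s t xs xt = spp_value m P p w s t xs xt"
      by (rule values_eq)
    show "\<exists>S. f2_optimal m P p w s t xs xt S" if "\<exists>S. f2_feasible m P p s t xs xt S"
      using that f2_optimal_exists by blast
    show "\<exists>\<gamma> \<in> simple_paths m P s t. path_arcs \<gamma> \<subseteq> {(i, j) \<in> arcs m P. zv S i j = 1} \<and>
        spp_optimal m P p w s t xs xt \<gamma> (gate_points P S)" if "f2_optimal m P p w s t xs xt S" for S
      using that by (rule f2_optimal_gate_path)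
    fix \<gamma> y assume opt: "spp_optimal m P p w s t xs xt \<gamma> y"
    then show "\<exists>lam. path_coefficients m P \<gamma> y lam"
      by (intro path_coefficients_exist) (simp add: spp_optimal_def)
    fix lam assume "path_coefficients m P \<gamma> y lam"
    with opt have "f2_optimal m P p w s t xs xt (path_solution \<gamma> lam)"
      by (rule path_solution_optimal)
    then show "\<exists>S. f2_optimal m P p w s t xs xt S \<and>
        (\<forall>(i, j) \<in> arcs m P. zv S i j = (if (i, j) \<in> path_arcs \<gamma> then 1 else 0)) \<and> lamv S = lam"
      by (intro exI[of _ "path_solution \<gamma> lam"]) (auto simp: path_solution_def path_flow_def)
  qed
qed

end
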